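(* Let $0\le\alpha<1$, $\theta>-\alpha$, and let $\rho_{\alpha,\theta}(s)=P_{\alpha,\theta}(sV_1<1)$ for $s\in\mathbf R$. Then $$(s-1)^\theta\rho_{\alpha,\theta}(s-1)+\int_{s-1}^s (s-t)^{-\alpha}t^\theta\,d\rho_{\alpha,\theta}(t)=0\qquad(s>1),$$ where the integral is a Lebesgue–Stieltjes integral with respect to the (non-increasing) function $\rho_{\alpha,\theta}$.
   Context: $\mathrm{PD}(\alpha,\theta)$ (for $0\le\alpha<1$, $\theta>-\alpha$): let $Y_1,Y_2,\dots$ be independent with $Y_i\sim\mathrm{Beta}(1-\alpha,\theta+i\alpha)$, put $\tilde V_1=Y_1$, $\tilde V_i=(1-Y_1)\cdots(1-Y_{i-1})Y_i$, and let $V_1\ge V_2\ge\cdots$ be the decreasing rearrangement of $(\tilde V_i)$; $\mathrm{PD}(\alpha,\theta)$ is the law of $(V_i)$. $P_{\alpha,\theta}$ denotes a probability under which $(V_i)$ is $\mathrm{PD}(\alpha,\theta)$-distributed. *)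

theory Defs
  imports "HOL-Probability.Probability"
begin

definition beta_density :: "real \<Rightarrow> real \<Rightarrow> real \<Rightarrow> real" where
  "beta_density a b x =
     indicator {0<..<1} x * x powr (a - 1) * (1 - x) powr (b - 1) / Beta a b"

definition beta_measure :: "real \<Rightarrow> real \<Rightarrow> real measure" where
  "beta_measure a b = density lborel (\<lambda>x. ennreal (beta_density a b x))"

text \<open>Probability space carrying independent Y_1, Y_2, ...; coordinate i of
  \<omega> is Y_(i+1) ~ Beta(1 - alpha, theta + (i+1) alpha).\<close>
definition PD_space :: "real \<Rightarrow> real \<Rightarrow> (nat \<Rightarrow> real) measure" where
  "PD_space \<alpha> \<theta> = PiM UNIV (\<lambda>i. beta_measure (1 - \<alpha>) (\<theta> + real (Suc i) * \<alpha>))"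

definition stick_weight :: "(nat \<Rightarrow> real) \<Rightarrow> nat \<Rightarrow> real" where
  "stick_weight \<omega> i = (\<Prod>j<i. 1 - \<omega> j) * \<omega> i"

text \<open>V_1, the largest element of the decreasing rearrangement.\<close>
definition PD_V1 :: "(nat \<Rightarrow> real) \<Rightarrow> real" where
  "PD_V1 \<omega> = (SUP i. stick_weight \<omega> i)"

definition PD_rho :: "real \<Rightarrow> real \<Rightarrow> real \<Rightarrow> real" where
  "PD_rho \<alpha> \<theta> s = measure (PD_space \<alpha> \<theta>) {\<omega> \<in> space (PD_space \<alpha> \<theta>). s * PD_V1 \<omega> < 1}"

text \<open>Lebesgue-Stieltjes integral over (a,b] with respect to a non-increasing,
  right-continuous function F: the integral w.r.t. the signed measure dF = - d(-F).\<close>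
definition LS_integral_decr :: "(real \<Rightarrow> real) \<Rightarrow> real \<Rightarrow> real \<Rightarrow> (real \<Rightarrow> real) \<Rightarrow> real" where
  "LS_integral_decr F a b f = - (LINT t:{a<..b}|interval_measure (\<lambda>x. - F x). f t)"

end

theory Submission
  imports Defs
begin

text \<open>Let \<open>b\<close> be the density of the first stick \<open>Y\<close> and write \<open>\<rho>\<close>, \<open>\<rho>'\<close> for the functions
  of types \<open>\<theta>\<close> and \<open>\<theta> + \<alpha>\<close>. Removing the first stick leaves a stick-breaking sequence of
  type \<open>\<theta> + \<alpha>\<close>, so \<open>V\<^sub>1 = max Y ((1 - Y) V')\<close> and
  \<open>\<rho> s = \<integral> b y * [s y < 1] * \<rho>' (s (1 - y)) dy\<close>. The other ingredient is that the first
  weight is a size-biased pick, so that \<open>V\<^sub>1\<close> has density \<open>b v / v * \<rho>' ((1 - v) / v)\<close>, that is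
  \<open>- t\<^sup>\<theta> d\<rho>(t) = (t - 1)\<^bsup>\<theta> + \<alpha> - 1\<^esup> \<rho>' (t - 1) dt / Beta (1 - \<alpha>) (\<theta> + \<alpha>)\<close> on \<open>t > 1\<close>.
  Inserting this in the integral and substituting \<open>t = s - (s - 1) y\<close> turns the integral into the
  first formula at \<open>s - 1\<close>. The density formula holds because both its integral and the tail of
  \<open>V\<^sub>1\<close> solve one first-stick recursion (for the integral this uses the symmetry of the joint
  density of the first two weights), and that recursion contracts functions of linear growth.\<close>

section \<open>Splitting off the first coordinate of a countable product\<close>

text \<open>The index set is 0 together with \<open>range Suc\<close>; Tonelli separates the two,
  and reindexing along \<open>Suc\<close> turns the second factor into a product over all of
  \<open>nat\<close> again.\<close>

lemma nn_integral_PiM_nat_split: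
  fixes M :: "nat \<Rightarrow> 'a measure"
  assumes M: "\<And>i. prob_space (M i)"
    and [measurable]: "g \<in> borel_measurable (PiM UNIV M)"
  shows "(\<integral>\<^sup>+\<omega>. g \<omega> \<partial>PiM UNIV M)
       = (\<integral>\<^sup>+x. \<integral>\<^sup>+\<omega>. g (case_nat x \<omega>) \<partial>PiM UNIV (\<lambda>i. M (Suc i)) \<partial>M 0)"
proof -
  let ?R = "PiM (range Suc) M" and ?S = "PiM UNIV (\<lambda>i. M (Suc i))"
  interpret R: prob_space ?R by (intro prob_space_PiM M)
  have U: "insert 0 (range Suc) = (UNIV :: nat set)"
    by (auto simp: image_iff) (metis not0_implies_Suc)
  have D: "distr (M 0 \<Otimes>\<^sub>M ?R) (PiM UNIV M) (\<lambda>(x, X). X(0 := x)) = PiM UNIV M"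
    using distr_pair_PiM_eq_PiM[of "range Suc" M 0] M unfolding U by auto
  have upd[measurable]: "(\<lambda>(x, X). X(0 := x)) \<in> measurable (M 0 \<Otimes>\<^sub>M ?R) (PiM UNIV M)"
    using measurable_fun_upd[of UNIV "range Suc" 0 snd "M 0 \<Otimes>\<^sub>M ?R" M fst] U
    by (simp add: split_beta')
  have sh[measurable]: "(\<lambda>\<omega>. \<lambda>n\<in>UNIV. \<omega> (Suc n)) \<in> measurable ?R ?S"
    by measurable
  have S: "distr ?R ?S (\<lambda>\<omega>. \<lambda>n\<in>UNIV. \<omega> (Suc n)) = ?S"
    by (rule distr_PiM_reindex) (auto intro: M)
  have cn: "case_nat x \<in> measurable ?S (PiM UNIV M)" if "x \<in> space (M 0)" for x
  proof (rule measurable_PiM_single')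
    show "(\<lambda>\<omega>. case_nat x \<omega> i) \<in> measurable ?S (M i)" for i
      using that by (cases i) simp_all
  qed (use that in \<open>auto simp: space_PiM PiE_iff split: nat.split\<close>)
  have "(\<integral>\<^sup>+\<omega>. g \<omega> \<partial>PiM UNIV M) = (\<integral>\<^sup>+z. g ((snd z)(0 := fst z)) \<partial>(M 0 \<Otimes>\<^sub>M ?R))"
    by (subst D[symmetric], subst nn_integral_distr[OF upd])
       (simp_all add: split_beta')
  also have "\<dots> = (\<integral>\<^sup>+x. \<integral>\<^sup>+X. g (X(0 := x)) \<partial>?R \<partial>M 0)"
    using measurable_compose[OF upd, of g borel]
    by (subst R.nn_integral_fst[symmetric]) (simp_all add: split_beta')
  also have "\<dots> = (\<integral>\<^sup>+x. \<integral>\<^sup>+\<omega>. g (case_nat x \<omega>) \<partial>?S \<partial>M 0)"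
  proof (rule nn_integral_cong)
    fix x assume x: "x \<in> space (M 0)"
    have "(\<integral>\<^sup>+\<omega>. g (case_nat x \<omega>) \<partial>?S)
        = (\<integral>\<^sup>+X. g (case_nat x (\<lambda>n\<in>UNIV. X (Suc n))) \<partial>?R)"
      by (subst S[symmetric], subst nn_integral_distr[OF sh])
         (simp_all add: measurable_compose[OF cn[OF x]])
    also have "\<dots> = (\<integral>\<^sup>+X. g (X(0 := x)) \<partial>?R)"
      by (intro nn_integral_cong arg_cong[of _ _ g]) (auto split: nat.split)
    finally show "(\<integral>\<^sup>+X. g (X(0 := x)) \<partial>?R) = (\<integral>\<^sup>+\<omega>. g (case_nat x \<omega>) \<partial>?S)" ..
  qed
  finally show ?thesis .
qed

section \<open>Beta laws\<close>

lemma Beta_real_pos: "0 < a \<Longrightarrow> 0 < b \<Longrightarrow> 0 < Beta a (b :: real)"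
  by (simp add: Beta_def Gamma_real_pos)

lemma beta_density_nonneg: "0 < a \<Longrightarrow> 0 < b \<Longrightarrow> 0 \<le> beta_density a b x"
  unfolding beta_density_def using Beta_real_pos[of a b]
  by (intro divide_nonneg_pos mult_nonneg_nonneg) auto

lemma measurable_beta_density [measurable]: "beta_density a b \<in> borel_measurable borel"
  unfolding beta_density_def by measurable

lemma nn_integral_beta_density:
  assumes "0 < a" "0 < b"
  shows "(\<integral>\<^sup>+x. ennreal (beta_density a b x) \<partial>lborel) = 1"
proof -
  have "((\<lambda>t. t powr (a - 1) * (1 - t) powr (b - 1) / Beta a b) has_integral 1) {0..1}"
    using has_integral_divide[OF has_integral_Beta_real[OF assms], of "Beta a b"]
      Beta_real_pos[OF assms] by simp
  then have "(\<integral>\<^sup>+x. ennreal (x powr (a - 1) * (1 - x) powr (b - 1) / Beta a b) * indicator {0..1} x \<partial>lborel) = 1"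
    using Beta_real_pos[OF assms]
    by (subst nn_integral_has_integral_lebesgue'[where I = 1]) auto
  moreover have "(\<integral>\<^sup>+x. ennreal (x powr (a - 1) * (1 - x) powr (b - 1) / Beta a b) * indicator {0..1} x \<partial>lborel)
     = (\<integral>\<^sup>+x. ennreal (beta_density a b x) \<partial>lborel)"
    by (intro nn_integral_cong_AE AE_I[of _ _ "{0, 1}"])
       (auto simp: beta_density_def indicator_def intro!: emeasure_lborel_countable)
  ultimately show ?thesis by simp
qed

lemma prob_space_beta_measure: "0 < a \<Longrightarrow> 0 < b \<Longrightarrow> prob_space (beta_measure a b)"
  by (rule prob_spaceI)
     (simp add: beta_measure_def emeasure_density nn_integral_beta_density)

lemma sets_beta_measure [measurable_cong, simp]: "sets (beta_measure a b) = sets borel"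
  by (simp add: beta_measure_def)

lemma space_beta_measure [simp]: "space (beta_measure a b) = UNIV"
  by (simp add: beta_measure_def)

lemma AE_beta_measure: "AE x in beta_measure a b. 0 < x \<and> x < 1"
  unfolding beta_measure_def by (subst AE_density) (auto simp: beta_density_def indicator_def)

section \<open>The largest weight as a function of the sticks\<close>

text \<open>Junk values: when the weights are unbounded, the supremum of reals is one fixed
  unspecified number.\<close>

lemma measurable_PD_V1:
  assumes "\<And>i. sets (M i) = sets borel"
  shows "PD_V1 \<in> borel_measurable (PiM UNIV M)"
proof -
  let ?P = "\<lambda>\<omega>. \<exists>n::nat. \<forall>i. stick_weight \<omega> i \<le> real n"
  let ?u = "LEAST z::real. False"
  have comp[measurable]: "(\<lambda>\<omega>. \<omega> i) \<in> borel_measurable (PiM UNIV M)" for i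
    using measurable_component_singleton[of i UNIV M] assms by (simp cong: measurable_cong_sets)
  have [measurable]: "(\<lambda>\<omega>. stick_weight \<omega> i) \<in> borel_measurable (PiM UNIV M)" for i
    unfolding stick_weight_def by measurable
  \<comment> \<open>A bounded family has the same supremum in \<open>ereal\<close>, where a
    countable supremum of measurable functions is measurable without a boundedness condition; off
    the measurable event \<open>?P\<close> the value is constant.\<close>
  have eq: "PD_V1 \<omega> = (if ?P \<omega> then real_of_ereal (SUP i. ereal (stick_weight \<omega> i)) else ?u)" for \<omega>
  proof (cases "?P \<omega>")
    case True
    then obtain n where n: "\<And>i. stick_weight \<omega> i \<le> real n" by auto
    have "(SUP i. ereal (stick_weight \<omega> i)) \<le> ereal (real n)"
      by (intro SUP_least) (simp add: n)
    moreover have "ereal (stick_weight \<omega> 0) \<le> (SUP i. ereal (stick_weight \<omega> i))"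
      by (rule SUP_upper) simp
    ultimately have "\<bar>SUP i. ereal (stick_weight \<omega> i)\<bar> \<noteq> \<infinity>"
      by auto
    from ereal_SUP[OF this] have "real_of_ereal (SUP i. ereal (stick_weight \<omega> i)) = PD_V1 \<omega>"
      unfolding PD_V1_def by (metis real_of_ereal.simps(1))
    with True show ?thesis by simp
  next
    case False
    have "\<not> (\<forall>i. stick_weight \<omega> i \<le> z)" for z
      using False by (meson order_trans real_arch_simple)
    then have "(\<lambda>z. \<forall>x\<in>range (stick_weight \<omega>). x \<le> z) = (\<lambda>z. False)"
      by (auto simp: fun_eq_iff)
    then have "PD_V1 \<omega> = ?u"
      unfolding PD_V1_def Sup_real_def by simp
    then show ?thesis
      using False by auto
  qed
  show ?thesis
    unfolding eq[abs_def] by measurable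
qed

lemma stick_weight_bounds:
  assumes "\<And>i. 0 < \<omega> i \<and> \<omega> i < 1"
  shows "0 \<le> stick_weight \<omega> i" "stick_weight \<omega> i \<le> 1"
proof -
  have *: "0 \<le> 1 - \<omega> j" "1 - \<omega> j \<le> 1" for j using assms[of j] by auto
  have p: "0 \<le> (\<Prod>j<i. 1 - \<omega> j)" "(\<Prod>j<i. 1 - \<omega> j) \<le> 1"
    using * by (auto intro!: prod_nonneg prod_le_1)
  show "0 \<le> stick_weight \<omega> i"
    using p assms[of i] by (simp add: stick_weight_def)
  show "stick_weight \<omega> i \<le> 1"
    unfolding stick_weight_def using p assms[of i] by (intro mult_le_one) auto
qed

lemma PD_V1_bounds:
  assumes "\<And>i. 0 < \<omega> i \<and> \<omega> i < 1"
  shows "0 \<le> PD_V1 \<omega>" "PD_V1 \<omega> \<le> 1"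
proof -
  have b: "bdd_above (range (stick_weight \<omega>))"
    using stick_weight_bounds(2)[OF assms] by (auto intro!: bdd_aboveI[of _ 1])
  show "0 \<le> PD_V1 \<omega>"
    unfolding PD_V1_def using order_trans[OF stick_weight_bounds(1)[of \<omega> 0, OF assms]] cSUP_upper[OF UNIV_I b]
    by blast
  show "PD_V1 \<omega> \<le> 1"
    unfolding PD_V1_def by (rule cSUP_least) (auto simp: stick_weight_bounds(2)[OF assms])
qed

lemma stick_weight_case_nat:
  "stick_weight (case_nat x \<omega>) 0 = x"
  "stick_weight (case_nat x \<omega>) (Suc i) = (1 - x) * stick_weight \<omega> i"
  by (simp_all add: stick_weight_def prod.lessThan_Suc_shift del: prod.lessThan_Suc)

text \<open>The weights after the first are those of the shifted sequence scaled by 1 - x. Sticks in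
  (0, 1) keep the weights bounded, so both suprema are genuine.\<close>

lemma PD_V1_case_nat:
  assumes x: "0 < x" "x < 1" and \<omega>: "\<And>i. 0 < \<omega> i \<and> \<omega> i < 1"
  shows "PD_V1 (case_nat x \<omega>) = max x ((1 - x) * PD_V1 \<omega>)"
proof -
  have xo: "0 < case_nat x \<omega> i \<and> case_nat x \<omega> i < 1" for i
    using x \<omega> by (auto split: nat.split)
  have b: "bdd_above (range (stick_weight \<omega>))" "bdd_above (range (stick_weight (case_nat x \<omega>)))"
    using stick_weight_bounds(2)[OF \<omega>] stick_weight_bounds(2)[OF xo]
    by (auto intro!: bdd_aboveI[of _ 1])
  have up: "stick_weight (case_nat x \<omega>) i \<le> PD_V1 (case_nat x \<omega>)" "stick_weight \<omega> i \<le> PD_V1 \<omega>" for i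
    unfolding PD_V1_def using b by (auto intro: cSUP_upper)
  have "stick_weight (case_nat x \<omega>) i \<le> max x ((1 - x) * PD_V1 \<omega>)" for i
    using x up(2) by (cases i) (auto simp: stick_weight_case_nat le_max_iff_disj)
  then have "PD_V1 (case_nat x \<omega>) \<le> max x ((1 - x) * PD_V1 \<omega>)"
    unfolding PD_V1_def by (intro cSUP_least) auto
  moreover have "x \<le> PD_V1 (case_nat x \<omega>)"
    using up(1)[of 0] by (simp add: stick_weight_case_nat)
  \<comment> \<open>Dividing by 1 - x frees the supremum of its factor, so that it can be bounded
    weight by weight.\<close>
  moreover have "PD_V1 \<omega> \<le> PD_V1 (case_nat x \<omega>) / (1 - x)"
    unfolding PD_V1_def[of \<omega>]
  proof (rule cSUP_least)
    show "stick_weight \<omega> i \<le> PD_V1 (case_nat x \<omega>) / (1 - x)" for i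
      using up(1)[of "Suc i"] x by (simp add: stick_weight_case_nat field_simps)
  qed simp
  then have "(1 - x) * PD_V1 \<omega> \<le> PD_V1 (case_nat x \<omega>)"
    using x by (simp add: field_simps)
  ultimately show ?thesis by simp
qed

section \<open>Exchange symmetry and integration against Beta laws\<close>

text \<open>The left side is 1 - y times the joint density of the first two weights at (y, w). The
  relation between \<open>a\<close>, \<open>b\<close> and \<open>b'\<close> makes all powers of 1 -
  y cancel; a multiple of (y w)^(a - 1) (1 - y - w)^(b' - 1) remains on the simplex, which is
  symmetric.\<close>

lemma beta_density_swap:
  assumes "b' = b + 1 - a"
  shows "beta_density a b y * beta_density a b' (w / (1 - y))
       = beta_density a b w * beta_density a b' (y / (1 - w))"
proof (cases "0 < y \<and> 0 < w \<and> y + w < 1")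
  case True
  have *: "beta_density a b y * beta_density a b' (w / (1 - y))
      = y powr (a - 1) * w powr (a - 1) * (1 - y - w) powr (b' - 1) / (Beta a b * Beta a b')"
    if "0 < y" "0 < w" "y + w < 1" for y w
  proof -
    have e: "1 - w / (1 - y) = (1 - y - w) / (1 - y)"
      using that by (simp add: field_simps)
    have "(1 - y) powr (b - 1) = (1 - y) powr (a - 1) * (1 - y) powr (b' - 1)"
      using that assms by (simp flip: powr_add)
    then show ?thesis
      using that unfolding beta_density_def e by (simp add: powr_divide)
  qed
  show ?thesis
    using True *[of y w] *[of w y] by (simp add: algebra_simps)
next
  case False
  have *: "beta_density a b y * beta_density a b' (w / (1 - y)) = 0"
    if "\<not> (0 < y \<and> 0 < w \<and> y + w < 1)" for y w
    using that by (auto simp: beta_density_def indicator_def field_simps)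
  show ?thesis
    unfolding *[OF False] using False by (subst *) auto
qed

lemma AE_beta_measure_neq: "AE x in beta_measure a b. x \<noteq> c"
  unfolding beta_measure_def using AE_lborel_singleton[of c]
  by (subst AE_density) auto

lemma nn_integral_beta_measure:
  assumes [measurable]: "f \<in> borel_measurable borel"
  shows "(\<integral>\<^sup>+x. f x \<partial>beta_measure a b) = (\<integral>\<^sup>+x. ennreal (beta_density a b x) * f x \<partial>lborel)"
  unfolding beta_measure_def by (subst nn_integral_density) simp_all

lemma integral_beta_measure:
  fixes f :: "real \<Rightarrow> real"
  assumes [measurable]: "f \<in> borel_measurable borel" and "0 < a" "0 < b"
  shows "(\<integral>x. f x \<partial>beta_measure a b) = (\<integral>x. beta_density a b x * f x \<partial>lborel)"
  unfolding beta_measure_def by (subst integral_density) (auto simp: beta_density_nonneg assms)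

text \<open>Multiplying the density by 1 - x raises its second parameter by one, so the mean is a
  quotient of two Beta values.\<close>

lemma expectation_beta_measure:
  assumes "0 < a" "0 < b"
  shows "(\<integral>x. 1 - x \<partial>beta_measure a b) = b / (a + b)"
proof -
  have *: "(\<integral>x. beta_density a (b + 1) x \<partial>lborel) = 1"
    using nn_integral_beta_density[of a "b + 1"] assms
    by (subst integral_eq_nn_integral) (auto simp: beta_density_nonneg)
  have "b \<notin> \<int>\<^sub>\<le>\<^sub>0" using assms by (auto simp: nonpos_Ints_def)
  then have q: "Beta a (b + 1) = b / (a + b) * Beta a b"
    using Beta_plus1_right[of b a] assms by (simp add: field_simps)
  have "beta_density a b x * (1 - x) = b / (a + b) * beta_density a (b + 1) x" for x
  proof (cases "0 < x \<and> x < 1")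
    case True
    have "(1 - x) powr b = (1 - x) powr (b - 1) * (1 - x)"
      using True powr_add[of "1 - x" "b - 1" 1] by simp
    then show ?thesis
      using True q assms Beta_real_pos[OF assms] by (simp add: beta_density_def)
  qed (auto simp: beta_density_def)
  then show ?thesis
    using assms * by (simp add: integral_beta_measure)
qed

section \<open>The size-biased tail and the change of variable to reciprocals\<close>

text \<open>By size-biasing, the largest weight has the law with density
  \<open>b w / w * P ((1 - w) V' < w)\<close>, where \<open>b\<close> is the density of the first weight and
  \<open>V'\<close> is the largest weight of type \<open>\<theta> + \<alpha>\<close>; this is its tail above \<open>1 / t\<close>.\<close>

definition PD_tail :: "real \<Rightarrow> real \<Rightarrow> real \<Rightarrow> ennreal" where
  "PD_tail \<alpha> \<theta> t = (\<integral>\<^sup>+w. indicator {w. 1 < t * w} w * ennreal (PD_rho \<alpha> (\<theta> + \<alpha>) ((1 - w) / w) / w)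
     \<partial>beta_measure (1 - \<alpha>) (\<theta> + \<alpha>))"

text \<open>The map u to 1 / u is decreasing. It is composed of a reflection and the increasing map
  u to -1 / u, whose derivative is 1 / u^2.\<close>

lemma nn_integral_inverse_substitution:
  fixes f :: "real \<Rightarrow> real"
  assumes [measurable]: "f \<in> borel_measurable borel" and t: "1 \<le> t"
  shows "(\<integral>\<^sup>+w. ennreal (f w) * indicator {1 / t..1} w \<partial>lborel)
       = (\<integral>\<^sup>+u. ennreal (f (1 / u) / u\<^sup>2) * indicator {1..t} u \<partial>lborel)"
proof -
  have "(\<integral>\<^sup>+w. ennreal (f w) * indicator {1 / t..1} w \<partial>lborel)
      = ennreal \<bar>-1\<bar> * (\<integral>\<^sup>+x. ennreal (f (0 + -1 * x)) * indicator {1 / t..1} (0 + -1 * x) \<partial>lborel)"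
    by (rule nn_integral_real_affine) simp_all
  also have "\<dots> = (\<integral>\<^sup>+x. ennreal (f (- x)) * indicator {- 1 / 1..- 1 / t} x \<partial>lborel)"
    by (simp, intro nn_integral_cong) (auto simp: indicator_def)
  also have "\<dots> = (\<integral>\<^sup>+u. ennreal (f (- (- 1 / u)) * (1 / u\<^sup>2)) * indicator {1..t} u \<partial>lborel)"
    unfolding nn_integral_set_ennreal using t by (intro nn_integral_substitution[where f = "\<lambda>x. f (- x)" and g = "\<lambda>u. - 1 / u"])
      (auto intro!: derivative_eq_intros continuous_intros simp: power2_eq_square set_borel_measurable_def)
  finally show ?thesis by simp
qed

text \<open>The candidate density of 1 / V_1: the size-biased density of V_1 carried over by w = 1 /
  u. It lives on u > 1 because the weights lie below 1.\<close>

definition PD_inverse_density :: "real \<Rightarrow> real \<Rightarrow> real \<Rightarrow> real" where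
  "PD_inverse_density \<alpha> \<theta> u = indicator {1<..} u *
     (u powr - \<theta> * (u - 1) powr (\<theta> + \<alpha> - 1) * PD_rho \<alpha> (\<theta> + \<alpha>) (u - 1) / Beta (1 - \<alpha>) (\<theta> + \<alpha>))"

section \<open>Monotonicity, measurability and easy values of \<rho>\<close>

context
  fixes \<alpha> :: real
  assumes \<alpha>: "0 \<le> \<alpha>" "\<alpha> < 1"
begin

lemma stick_parameters_pos:
  assumes "0 < \<theta> + \<alpha>"
  shows "0 < \<theta> + real (Suc i) * \<alpha>"
proof -
  have "0 \<le> real i * \<alpha>" using \<alpha> by simp
  then show ?thesis using assms by (simp add: distrib_right)
qed

lemma prob_space_stick:
  "0 < \<theta> + \<alpha> \<Longrightarrow> prob_space (beta_measure (1 - \<alpha>) (\<theta> + real (Suc i) * \<alpha>))"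
  using \<alpha> by (intro prob_space_beta_measure stick_parameters_pos) auto

lemma prob_space_PD_space: "0 < \<theta> + \<alpha> \<Longrightarrow> prob_space (PD_space \<alpha> \<theta>)"
  unfolding PD_space_def by (intro prob_space_PiM prob_space_stick)

lemma AE_PD_space:
  assumes "0 < \<theta> + \<alpha>"
  shows "AE \<omega> in PD_space \<alpha> \<theta>. \<forall>i. 0 < \<omega> i \<and> \<omega> i < 1"
proof -
  interpret product_prob_space "\<lambda>i. beta_measure (1 - \<alpha>) (\<theta> + real (Suc i) * \<alpha>)" UNIV
    by (intro product_prob_spaceI prob_space_stick assms)
  show ?thesis
    unfolding PD_space_def AE_all_countable by (intro allI AE_component AE_beta_measure) simp
qed

lemma measurable_PD_V1' [measurable]: "PD_V1 \<in> borel_measurable (PD_space \<alpha> \<theta>)"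
  unfolding PD_space_def by (rule measurable_PD_V1) simp

lemma PD_rho_bounds: "0 \<le> PD_rho \<alpha> \<theta> t" "0 < \<theta> + \<alpha> \<Longrightarrow> PD_rho \<alpha> \<theta> t \<le> 1"
  by (auto simp: PD_rho_def intro: prob_space.prob_le_1[OF prob_space_PD_space])

text \<open>The sign of V_1 is controlled only almost surely, so the two events are nested only up
  to a null set.\<close>

lemma PD_rho_antimono:
  assumes "0 < \<theta> + \<alpha>" "s \<le> t"
  shows "PD_rho \<alpha> \<theta> t \<le> PD_rho \<alpha> \<theta> s"
proof -
  interpret prob_space "PD_space \<alpha> \<theta>" using assms(1) by (rule prob_space_PD_space)
  show ?thesis
    unfolding PD_rho_def
  proof (rule finite_measure_mono_AE)
    show "AE \<omega> in PD_space \<alpha> \<theta>. \<omega> \<in> {\<omega> \<in> space (PD_space \<alpha> \<theta>). t * PD_V1 \<omega> < 1} \<longrightarrow>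
        \<omega> \<in> {\<omega> \<in> space (PD_space \<alpha> \<theta>). s * PD_V1 \<omega> < 1}"
      using AE_PD_space[OF assms(1)]
    proof eventually_elim
      case (elim \<omega>)
      then have "s * PD_V1 \<omega> \<le> t * PD_V1 \<omega>"
        using PD_V1_bounds[of \<omega>] assms(2) by (intro mult_right_mono) auto
      then show ?case by auto
    qed
  qed measurable
qed

lemma measurable_PD_rho:
  assumes "0 < \<theta> + \<alpha>"
  shows "PD_rho \<alpha> \<theta> \<in> borel_measurable borel"
proof -
  have "mono (\<lambda>t. - PD_rho \<alpha> \<theta> t)"
    using PD_rho_antimono[OF assms] by (intro monoI) simp
  from borel_measurable_uminus[OF borel_measurable_mono[OF this]] show ?thesis by simp
qed

text \<open>The bound V_1 \<le> 1 gives the strict inequality only for t < 1; the value at t = 1 is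
  obtained in \<open>PD_rho_eq_1\<close> from the recursion.\<close>

lemma PD_rho_eq_1_of_less_1:
  assumes "0 < \<theta> + \<alpha>" "t < 1"
  shows "PD_rho \<alpha> \<theta> t = 1"
proof -
  interpret prob_space "PD_space \<alpha> \<theta>" using assms(1) by (rule prob_space_PD_space)
  have "AE \<omega> in PD_space \<alpha> \<theta>. t * PD_V1 \<omega> < 1"
    using AE_PD_space[OF assms(1)]
  proof eventually_elim
    case (elim \<omega>)
    \<comment> \<open>Passing to \<open>max t 0\<close> covers negative t, for which V_1 \<le> 1
      does not bound t V_1 by t.\<close>
    then have "t * PD_V1 \<omega> \<le> max t 0 * PD_V1 \<omega>" "max t 0 * PD_V1 \<omega> \<le> max t 0 * 1"
      using PD_V1_bounds[of \<omega>] by (blast intro: mult_right_mono mult_left_mono max.cobounded1 max.cobounded2)+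
    then show ?case using assms(2) by linarith
  qed
  then show ?thesis
    unfolding PD_rho_def by (intro prob_eq_1[THEN iffD2]) auto
qed

section \<open>First-stick recursion for \<rho>\<close>

text \<open>The largest weight is the maximum of the first weight \<open>x\<close> and of \<open>1 - x\<close> times
  the largest weight of the remaining sticks, which are of type \<open>\<theta> + \<alpha>\<close>.\<close>

lemma PD_rho_first_stick:
  assumes \<theta>: "0 < \<theta> + \<alpha>" and t: "0 < t"
  shows "ennreal (PD_rho \<alpha> \<theta> t)
       = (\<integral>\<^sup>+x. indicator {x. t * x < 1} x * ennreal (PD_rho \<alpha> (\<theta> + \<alpha>) (t * (1 - x)))
            \<partial>beta_measure (1 - \<alpha>) (\<theta> + \<alpha>))"
proof -
  let ?M = "\<lambda>i. beta_measure (1 - \<alpha>) (\<theta> + real (Suc i) * \<alpha>)"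
  let ?P = "PD_space \<alpha> \<theta>" and ?Q = "PD_space \<alpha> (\<theta> + \<alpha>)"
  interpret P: prob_space ?P using \<theta> by (rule prob_space_PD_space)
  have \<theta>': "0 < (\<theta> + \<alpha>) + \<alpha>" using \<theta> \<alpha> by linarith
  interpret Q: prob_space ?Q using \<theta>' by (rule prob_space_PD_space)
  have shift: "PiM UNIV (\<lambda>i. ?M (Suc i)) = ?Q"
    unfolding PD_space_def by (intro PiM_cong refl) (simp add: algebra_simps)
  define g :: "(nat \<Rightarrow> real) \<Rightarrow> ennreal" where "g = indicator {\<omega> \<in> space ?P. t * PD_V1 \<omega> < 1}"
  have g: "g \<in> borel_measurable (PiM UNIV ?M)"
    unfolding g_def PD_space_def[symmetric] by measurable
  have "ennreal (PD_rho \<alpha> \<theta> t) = emeasure ?P {\<omega> \<in> space ?P. t * PD_V1 \<omega> < 1}"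
    by (simp add: PD_rho_def P.emeasure_eq_measure)
  also have "\<dots> = (\<integral>\<^sup>+\<omega>. g \<omega> \<partial>PiM UNIV ?M)"
    unfolding g_def PD_space_def[symmetric] by (subst nn_integral_indicator) measurable
  also have "\<dots> = (\<integral>\<^sup>+x. \<integral>\<^sup>+\<omega>. g (case_nat x \<omega>) \<partial>?Q \<partial>?M 0)"
    unfolding shift[symmetric] by (rule nn_integral_PiM_nat_split[OF prob_space_stick[OF \<theta>] g])
  also have "\<dots> = (\<integral>\<^sup>+x. indicator {x. t * x < 1} x * ennreal (PD_rho \<alpha> (\<theta> + \<alpha>) (t * (1 - x))) \<partial>?M 0)"
  proof (rule nn_integral_cong_AE)
    show "AE x in ?M 0. (\<integral>\<^sup>+\<omega>. g (case_nat x \<omega>) \<partial>?Q)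
        = indicator {x. t * x < 1} x * ennreal (PD_rho \<alpha> (\<theta> + \<alpha>) (t * (1 - x)))"
      using AE_beta_measure
    proof eventually_elim
      case (elim x)
      have "(\<integral>\<^sup>+\<omega>. g (case_nat x \<omega>) \<partial>?Q)
          = (\<integral>\<^sup>+\<omega>. indicator {x. t * x < 1} x * indicator {\<omega> \<in> space ?Q. t * (1 - x) * PD_V1 \<omega> < 1} \<omega> \<partial>?Q)"
      proof (rule nn_integral_cong_AE)
        show "AE \<omega> in ?Q. g (case_nat x \<omega>)
          = indicator {x. t * x < 1} x * indicator {\<omega> \<in> space ?Q. t * (1 - x) * PD_V1 \<omega> < 1} \<omega>"
          using AE_PD_space[OF \<theta>']
        proof eventually_elim
          case (elim \<omega>)
          \<comment> \<open>Since t > 0, multiplication by t passes through the maximum, and the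
            event becomes an intersection of a condition on x and one on the remaining
            sticks.\<close>
          have "t * PD_V1 (case_nat x \<omega>) = max (t * x) (t * (1 - x) * PD_V1 \<omega>)"
            using PD_V1_case_nat[of x \<omega>] elim \<open>0 < x \<and> x < 1\<close> t
            by (simp add: max_mult_distrib_left mult.assoc)
          then show ?case
            by (auto simp: g_def indicator_def PD_space_def space_PiM)
        qed
      qed
      also have "\<dots> = indicator {x. t * x < 1} x * emeasure ?Q {\<omega> \<in> space ?Q. t * (1 - x) * PD_V1 \<omega> < 1}"
        by (subst nn_integral_cmult) (simp_all add: nn_integral_indicator)
      finally show ?case by (simp add: PD_rho_def Q.emeasure_eq_measure)
    qed
  qed
  finally show ?thesis by simp
qed

section \<open>Recursion for the size-biased tail\<close>

lemma measurable_PD_tail: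
  assumes \<theta>: "0 < \<theta> + \<alpha>"
  shows "PD_tail \<alpha> \<theta> \<in> borel_measurable borel"
proof -
  interpret prob_space "beta_measure (1 - \<alpha>) (\<theta> + \<alpha>)"
    using \<alpha> \<theta> by (intro prob_space_beta_measure) auto
  have [measurable]: "PD_rho \<alpha> (\<theta> + \<alpha>) \<in> borel_measurable borel"
    using \<alpha> \<theta> by (intro measurable_PD_rho) auto
  show ?thesis
    unfolding PD_tail_def by measurable
qed

text \<open>On the event 1 < t w the weight 1 / w is below t. This linear growth is what the
  contraction argument starts from.\<close>

lemma PD_tail_le:
  assumes \<theta>: "0 < \<theta> + \<alpha>"
  shows "PD_tail \<alpha> \<theta> t \<le> ennreal t"
proof -
  interpret prob_space "beta_measure (1 - \<alpha>) (\<theta> + \<alpha>)"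
    using \<alpha> \<theta> by (intro prob_space_beta_measure) auto
  have "PD_tail \<alpha> \<theta> t \<le> (\<integral>\<^sup>+w. ennreal t \<partial>beta_measure (1 - \<alpha>) (\<theta> + \<alpha>))"
    unfolding PD_tail_def
  proof (rule nn_integral_mono_AE)
    show "AE w in beta_measure (1 - \<alpha>) (\<theta> + \<alpha>).
        indicator {w. 1 < t * w} w * ennreal (PD_rho \<alpha> (\<theta> + \<alpha>) ((1 - w) / w) / w) \<le> ennreal t"
      using AE_beta_measure
    proof eventually_elim
      case (elim w)
      have "PD_rho \<alpha> (\<theta> + \<alpha>) ((1 - w) / w) \<le> 1"
        using \<alpha> \<theta> by (intro PD_rho_bounds) auto
      then have "PD_rho \<alpha> (\<theta> + \<alpha>) ((1 - w) / w) / w \<le> t" if "1 < t * w"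
        using elim that by (simp add: field_simps)
      then show ?case by (auto simp: indicator_def intro!: ennreal_leI)
    qed
  qed
  then show ?thesis by (simp add: emeasure_space_1[simplified])
qed

lemma PD_tail_eq_0:
  assumes "t \<le> 1"
  shows "PD_tail \<alpha> \<theta> t = 0"
proof -
  have "PD_tail \<alpha> \<theta> t = (\<integral>\<^sup>+w. 0 \<partial>beta_measure (1 - \<alpha>) (\<theta> + \<alpha>))"
    unfolding PD_tail_def
  proof (rule nn_integral_cong_AE)
    show "AE w in beta_measure (1 - \<alpha>) (\<theta> + \<alpha>).
        indicator {w. 1 < t * w} w * ennreal (PD_rho \<alpha> (\<theta> + \<alpha>) ((1 - w) / w) / w) = 0"
      using AE_beta_measure
    proof eventually_elim
      case (elim w)
      then have "t * w \<le> 1 * w" using assms by (intro mult_right_mono) auto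
      then have "\<not> 1 < t * w" using elim by linarith
      then show ?case by simp
    qed
  qed
  then show ?thesis by simp
qed

text \<open>Exchanging the first two weights is a symmetry of their joint density up to the factor
  absorbed by size-biasing, so the size-biased tail obeys the same first-stick recursion as the
  tail of the largest weight.\<close>

lemma PD_tail_first_stick:
  assumes \<theta>: "0 < \<theta> + \<alpha>" and t: "0 < t"
  shows "PD_tail \<alpha> \<theta> t =
      (\<integral>\<^sup>+w. indicator {w. 1 < t * w} w * ennreal (PD_rho \<alpha> (\<theta> + \<alpha>) ((1 - w) / w))
         \<partial>beta_measure (1 - \<alpha>) (\<theta> + \<alpha>))
    + (\<integral>\<^sup>+y. PD_tail \<alpha> (\<theta> + \<alpha>) ((1 - y) * min t (1 / y)) \<partial>beta_measure (1 - \<alpha>) (\<theta> + \<alpha>))"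
proof -
  define b1 where "b1 = beta_density (1 - \<alpha>) (\<theta> + \<alpha>)"
  define b2 where "b2 = beta_density (1 - \<alpha>) (\<theta> + \<alpha> + \<alpha>)"
  define r1 where "r1 = PD_rho \<alpha> (\<theta> + \<alpha>)"
  define r2 where "r2 = PD_rho \<alpha> (\<theta> + \<alpha> + \<alpha>)"
  define I :: "real \<Rightarrow> ennreal" where "I = indicator {w. 1 < t * w}"
  have \<theta>': "0 < \<theta> + \<alpha> + \<alpha>" "0 < \<theta> + \<alpha> + \<alpha> + \<alpha>" using \<theta> \<alpha> by auto
  have [measurable]: "b1 \<in> borel_measurable borel" "b2 \<in> borel_measurable borel"
    "r1 \<in> borel_measurable borel" "r2 \<in> borel_measurable borel" "I \<in> borel_measurable borel"
    using \<alpha> \<theta>' by (auto simp: b1_def b2_def r1_def r2_def I_def intro!: measurable_PD_rho)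
  have [measurable]: "PD_tail \<alpha> (\<theta> + \<alpha>) \<in> borel_measurable borel"
    using \<theta>' by (intro measurable_PD_tail)
  have nn: "0 \<le> b1 x" "0 \<le> b2 x" "0 \<le> r1 x" "0 \<le> r2 x" for x
    using \<alpha> \<theta> \<theta>' by (auto simp: b1_def b2_def r1_def r2_def beta_density_nonneg PD_rho_bounds)
  have b1_0: "b1 x = 0" if "\<not> (0 < x \<and> x < 1)" for x
    using that by (auto simp: b1_def beta_density_def)
  have b2_0: "b2 x = 0" if "\<not> (0 < x \<and> x < 1)" for x
    using that by (auto simp: b2_def beta_density_def)
  have swap: "b1 y * b2 (w / (1 - y)) = b1 w * b2 (y / (1 - w))" for y w
    unfolding b1_def b2_def by (rule beta_density_swap) simp

  \<comment> \<open>Here y and w are the first two weights. The kernel asks that w exceed 1 / t, y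
    and all later weights, and carries the size-biasing factor (1 - y) / w, whose numerator is
    hidden in the product of densities.\<close>
  let ?k = "\<lambda>y w. ennreal (b1 y * b2 (w / (1 - y))) * (I w * indicator {w. y < w} w * ennreal (r2 ((1 - y - w) / w) / w))"

  \<comment> \<open>Substituting w = (1 - y) v passes from the second stick to the second weight;
    the Jacobian 1 / (1 - y) cancels against 1 / v = (1 - y) / w.\<close>
  have inner1: "ennreal (b1 y) * PD_tail \<alpha> (\<theta> + \<alpha>) ((1 - y) * min t (1 / y)) = (\<integral>\<^sup>+w. ?k y w \<partial>lborel)" for y
  proof (cases "0 < y \<and> y < 1")
    case True
    then have y: "0 < y" "y < 1" by auto
    have "PD_tail \<alpha> (\<theta> + \<alpha>) ((1 - y) * min t (1 / y)) =
       (\<integral>\<^sup>+v. ennreal (b2 v) * (indicator {v. 1 < (1 - y) * min t (1 / y) * v} v * ennreal (r2 ((1 - v) / v) / v)) \<partial>lborel)"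
      unfolding PD_tail_def b2_def r2_def[symmetric] by (subst nn_integral_beta_measure) simp_all
    also have "\<dots> = ennreal \<bar>1 / (1 - y)\<bar> * (\<integral>\<^sup>+w. ennreal (b2 (0 + 1 / (1 - y) * w)) *
        (indicator {v. 1 < (1 - y) * min t (1 / y) * v} (0 + 1 / (1 - y) * w)
          * ennreal (r2 ((1 - (0 + 1 / (1 - y) * w)) / (0 + 1 / (1 - y) * w)) / (0 + 1 / (1 - y) * w))) \<partial>lborel)"
      using y by (intro nn_integral_real_affine) simp_all
    finally have "ennreal (b1 y) * PD_tail \<alpha> (\<theta> + \<alpha>) ((1 - y) * min t (1 / y)) =
        (\<integral>\<^sup>+w. ennreal (b1 y) * (ennreal \<bar>1 / (1 - y)\<bar> * (ennreal (b2 (0 + 1 / (1 - y) * w)) *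
        (indicator {v. 1 < (1 - y) * min t (1 / y) * v} (0 + 1 / (1 - y) * w)
          * ennreal (r2 ((1 - (0 + 1 / (1 - y) * w)) / (0 + 1 / (1 - y) * w)) / (0 + 1 / (1 - y) * w))))) \<partial>lborel)"
      by (simp add: nn_integral_cmult)
    also have "\<dots> = (\<integral>\<^sup>+w. ?k y w \<partial>lborel)"
    proof (rule nn_integral_cong)
      fix w :: real
      show "ennreal (b1 y) * (ennreal \<bar>1 / (1 - y)\<bar> * (ennreal (b2 (0 + 1 / (1 - y) * w)) *
        (indicator {v. 1 < (1 - y) * min t (1 / y) * v} (0 + 1 / (1 - y) * w)
          * ennreal (r2 ((1 - (0 + 1 / (1 - y) * w)) / (0 + 1 / (1 - y) * w)) / (0 + 1 / (1 - y) * w))))) = ?k y w"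
      proof (cases "0 < w / (1 - y) \<and> w / (1 - y) < 1")
        case False
        then show ?thesis using b2_0[of "w / (1 - y)"] by simp
      next
        case True
        then have w: "0 < w" "w < 1 - y" using y by (auto simp: field_simps)
        \<comment> \<open>The threshold with \<open>min t (1 / y)\<close> encodes both t w > 1 and w
          > y.\<close>
        have i: "indicator {v. 1 < (1 - y) * min t (1 / y) * v} (0 + 1 / (1 - y) * w) = I w * indicator {w. y < w} w"
        proof -
          have "(1 - y) * min t (1 / y) * (0 + 1 / (1 - y) * w) = min t (1 / y) * w"
            using y by simp
          also have "\<dots> = min (t * w) (w / y)"
            using w by (simp add: min_mult_distrib_right)
          finally show ?thesis
            using y by (auto simp: I_def indicator_def)
        qed
        have e: "(1 - (0 + 1 / (1 - y) * w)) / (0 + 1 / (1 - y) * w) = (1 - y - w) / w"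
          using y w by (simp add: field_simps)
        have q: "r2 x / (0 + 1 / (1 - y) * w) = (1 - y) * (r2 x / w)" for x
          using y w by (simp add: field_simps)
        have c: "ennreal \<bar>1 / (1 - y)\<bar> * ennreal ((1 - y) * (r2 ((1 - y - w) / w) / w))
            = ennreal (r2 ((1 - y - w) / w) / w)"
          using y w nn by (simp flip: ennreal_mult add: ennreal_mult')
        have ac: "p * (q * (r * (s * u))) = p * r * (s * (q * u))" for p q r s u :: ennreal
          by (simp only: mult_ac)
        have v: "0 + 1 / (1 - y) * w = w / (1 - y)" by simp
        show ?thesis
          unfolding i e q ac c unfolding v ennreal_mult[OF nn(1) nn(2)] ..
      qed
    qed
    finally show ?thesis .
  qed (simp add: b1_0)

  \<comment> \<open>For fixed w the densities are exchanged and y = (1 - w) z is substituted. The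
    integral over z is then the first-stick recursion for \<open>r1\<close> at (1 - w) / w; the
    Jacobian 1 - w and the factor 1 / w stay outside.\<close>
  have inner2: "(\<integral>\<^sup>+y. ?k y w \<partial>lborel) = ennreal (b1 w) * (I w * ennreal ((1 - w) / w * r1 ((1 - w) / w)))" for w
  proof (cases "0 < w \<and> w < 1")
    case True
    then have w: "0 < w" "w < 1" by auto
    have "ennreal (r1 ((1 - w) / w)) = (\<integral>\<^sup>+z. indicator {z. (1 - w) / w * z < 1} z * ennreal (r2 ((1 - w) / w * (1 - z)))
        \<partial>beta_measure (1 - \<alpha>) (\<theta> + \<alpha> + \<alpha>))"
      unfolding r1_def r2_def using w \<theta>' \<alpha> by (intro PD_rho_first_stick) auto
    also have "\<dots> = (\<integral>\<^sup>+z. ennreal (b2 z) * (indicator {z. (1 - w) / w * z < 1} z * ennreal (r2 ((1 - w) / w * (1 - z)))) \<partial>lborel)"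
      unfolding b2_def by (rule nn_integral_beta_measure) measurable
    finally have first: "ennreal (r1 ((1 - w) / w)) = \<dots>" .
    have r1: "ennreal ((1 - w) / w * r1 ((1 - w) / w)) = ennreal (1 / w) * (ennreal (1 - w) *
        (\<integral>\<^sup>+z. ennreal (b2 z) * (indicator {z. (1 - w) / w * z < 1} z * ennreal (r2 ((1 - w) / w * (1 - z)))) \<partial>lborel))"
      unfolding first[symmetric] using w nn by (simp flip: ennreal_mult)
    have "(\<integral>\<^sup>+y. ?k y w \<partial>lborel)
        = ennreal \<bar>1 - w\<bar> * (\<integral>\<^sup>+z. ?k (0 + (1 - w) * z) w \<partial>lborel)"
      using w by (intro nn_integral_real_affine) simp_all
    also have "(\<integral>\<^sup>+z. ?k (0 + (1 - w) * z) w \<partial>lborel)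
        = (\<integral>\<^sup>+z. (ennreal (b1 w) * I w * ennreal (1 / w)) *
            (ennreal (b2 z) * (indicator {z. (1 - w) / w * z < 1} z * ennreal (r2 ((1 - w) / w * (1 - z))))) \<partial>lborel)"
    proof (rule nn_integral_cong)
      fix z :: real
      have s: "b1 (0 + (1 - w) * z) * b2 (w / (1 - (0 + (1 - w) * z))) = b1 w * b2 z"
        using swap[of "(1 - w) * z" w] w by simp
      have i: "indicator {v. 0 + (1 - w) * z < v} w = (indicator {z. (1 - w) / w * z < 1} z :: ennreal)"
        using w by (auto simp: indicator_def field_simps)
      have e: "(1 - (0 + (1 - w) * z) - w) / w = (1 - w) / w * (1 - z)"
        using w by (simp add: field_simps)
      have q: "ennreal (r2 x / w) = ennreal (1 / w) * ennreal (r2 x)" for x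
        using w nn by (simp flip: ennreal_mult)
      show "?k (0 + (1 - w) * z) w = (ennreal (b1 w) * I w * ennreal (1 / w)) *
            (ennreal (b2 z) * (indicator {z. (1 - w) / w * z < 1} z * ennreal (r2 ((1 - w) / w * (1 - z)))))"
        unfolding s i e q using nn by (simp add: ennreal_mult mult_ac)
    qed
    also have "\<dots> = (ennreal (b1 w) * I w * ennreal (1 / w)) * (\<integral>\<^sup>+z.
            (ennreal (b2 z) * (indicator {z. (1 - w) / w * z < 1} z * ennreal (r2 ((1 - w) / w * (1 - z))))) \<partial>lborel)"
      by (rule nn_integral_cmult) simp
    finally show ?thesis
      unfolding r1 using w by (simp add: mult_ac)
  next
    case False
    have z: "b1 y * b2 (w / (1 - y)) = 0" for y
      unfolding swap using False b1_0 by simp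
    show ?thesis unfolding z using False b1_0 by simp
  qed

  have "(\<integral>\<^sup>+y. PD_tail \<alpha> (\<theta> + \<alpha>) ((1 - y) * min t (1 / y)) \<partial>beta_measure (1 - \<alpha>) (\<theta> + \<alpha>))
      = (\<integral>\<^sup>+y. \<integral>\<^sup>+w. ?k y w \<partial>lborel \<partial>lborel)"
    by (simp add: nn_integral_beta_measure b1_def[symmetric] inner1)
  also have "\<dots> = (\<integral>\<^sup>+w. \<integral>\<^sup>+y. ?k y w \<partial>lborel \<partial>lborel)"
    by (rule lborel_pair.Fubini') measurable
  also have "\<dots> = (\<integral>\<^sup>+w. ennreal (b1 w) * (I w * ennreal ((1 - w) / w * r1 ((1 - w) / w))) \<partial>lborel)"
    by (simp only: inner2)
  finally have 2: "(\<integral>\<^sup>+y. PD_tail \<alpha> (\<theta> + \<alpha>) ((1 - y) * min t (1 / y)) \<partial>beta_measure (1 - \<alpha>) (\<theta> + \<alpha>)) = \<dots>" .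
  have 1: "(\<integral>\<^sup>+w. indicator {w. 1 < t * w} w * ennreal (PD_rho \<alpha> (\<theta> + \<alpha>) ((1 - w) / w)) \<partial>beta_measure (1 - \<alpha>) (\<theta> + \<alpha>))
      = (\<integral>\<^sup>+w. ennreal (b1 w) * (I w * ennreal (r1 ((1 - w) / w))) \<partial>lborel)"
    unfolding I_def[symmetric] r1_def[symmetric] by (simp add: nn_integral_beta_measure b1_def)
  have 0: "PD_tail \<alpha> \<theta> t = (\<integral>\<^sup>+w. ennreal (b1 w) * (I w * ennreal (r1 ((1 - w) / w) / w)) \<partial>lborel)"
    unfolding PD_tail_def I_def[symmetric] r1_def[symmetric] by (simp add: nn_integral_beta_measure b1_def)
  show ?thesis
    unfolding 0 1 2
  proof (subst nn_integral_add[symmetric])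
    \<comment> \<open>This is 1 / w = 1 + (1 - w) / w: the first term is the case where the first
      weight is the largest, the second is the double integral just computed.\<close>
    have "ennreal (b1 w) * (I w * ennreal (r1 ((1 - w) / w) / w)) =
        ennreal (b1 w) * (I w * ennreal (r1 ((1 - w) / w))) +
        ennreal (b1 w) * (I w * ennreal ((1 - w) / w * r1 ((1 - w) / w)))" for w
    proof (cases "0 < w \<and> w < 1")
      case True
      then have "r1 ((1 - w) / w) / w = r1 ((1 - w) / w) + (1 - w) / w * r1 ((1 - w) / w)"
        by (simp add: field_simps)
      then have "ennreal (r1 ((1 - w) / w) / w) = ennreal (r1 ((1 - w) / w)) + ennreal ((1 - w) / w * r1 ((1 - w) / w))"
        using True nn by (simp add: ennreal_plus)
      then show ?thesis by (simp add: distrib_left)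
    qed (simp add: b1_0)
    then show "(\<integral>\<^sup>+w. ennreal (b1 w) * (I w * ennreal (r1 ((1 - w) / w) / w)) \<partial>lborel) =
       (\<integral>\<^sup>+w. ennreal (b1 w) * (I w * ennreal (r1 ((1 - w) / w))) +
        ennreal (b1 w) * (I w * ennreal ((1 - w) / w * r1 ((1 - w) / w))) \<partial>lborel)"
      by simp
  qed measurable
qed

section \<open>Contraction and identification of the two tails\<close>

text \<open>The factors are the means of 1 - Y for the successive sticks. Each is at most exp(-c /
  (k + 1)), and the harmonic series diverges.\<close>

lemma prod_stick_means_tendsto_0:
  assumes \<theta>: "0 < \<theta> + \<alpha>"
  shows "(\<lambda>n. \<Prod>k<n. (\<theta> + real (Suc k) * \<alpha>) / (\<theta> + real k * \<alpha> + 1)) \<longlonglongrightarrow> 0"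
proof -
  \<comment> \<open>Chosen so that the bound \<theta> + k \<alpha> + 1 \<le> (|\<theta>| + 1) (k +
    1) turns (1 - \<alpha>) / (\<theta> + k \<alpha> + 1) into at least c / (k + 1).\<close>
  define c where "c = (1 - \<alpha>) / (\<bar>\<theta>\<bar> + 1)"
  have c: "0 < c" using \<alpha> by (simp add: c_def)
  have nn: "0 < \<theta> + real (Suc k) * \<alpha>" for k
    using stick_parameters_pos[OF \<theta>] .
  have pos: "0 < \<theta> + real k * \<alpha> + 1" for k
    using nn[of k] \<alpha> by (simp add: distrib_right)
  have fac: "(\<theta> + real (Suc k) * \<alpha>) / (\<theta> + real k * \<alpha> + 1) \<le> exp (- (c * inverse (real (Suc k))))" for k
  proof -
    have "real k * \<alpha> \<le> real k" using \<alpha> by (simp add: mult_left_le)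
    then have "\<theta> + real k * \<alpha> + 1 \<le> (\<bar>\<theta>\<bar> + 1) + real k" by linarith
    also have "\<dots> \<le> (\<bar>\<theta>\<bar> + 1) * real (Suc k)"
      by (simp add: algebra_simps)
    finally have "(1 - \<alpha>) / ((\<bar>\<theta>\<bar> + 1) * real (Suc k)) \<le> (1 - \<alpha>) / (\<theta> + real k * \<alpha> + 1)"
      using \<alpha> pos[of k] by (intro divide_left_mono) auto
    then have "c * inverse (real (Suc k)) \<le> (1 - \<alpha>) / (\<theta> + real k * \<alpha> + 1)"
      by (simp add: c_def divide_simps)
    moreover have "(\<theta> + real (Suc k) * \<alpha>) / (\<theta> + real k * \<alpha> + 1) = 1 - (1 - \<alpha>) / (\<theta> + real k * \<alpha> + 1)"
      using pos[of k] by (simp add: field_simps)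
    ultimately show ?thesis
      using exp_ge_add_one_self[of "- (c * inverse (real (Suc k)))"] by linarith
  qed
  have le: "(\<Prod>k<n. (\<theta> + real (Suc k) * \<alpha>) / (\<theta> + real k * \<alpha> + 1)) \<le> exp (- (c * harm n))" for n
  proof -
    have "(\<Prod>k<n. (\<theta> + real (Suc k) * \<alpha>) / (\<theta> + real k * \<alpha> + 1)) \<le> (\<Prod>k<n. exp (- (c * inverse (real (Suc k)))))"
      using nn pos fac by (intro prod_mono) (auto simp: less_imp_le simp del: of_nat_Suc)
    also have "\<dots> = exp (- (c * harm n))"
      by (simp add: exp_sum[symmetric] harm_def sum_negf sum_distrib_left sum.atLeast1_atMost_eq del: of_nat_Suc)
    finally show ?thesis .
  qed
  have lim: "(\<lambda>n. exp (- (c * harm n))) \<longlonglongrightarrow> 0"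
    using c by (intro filterlim_compose[OF exp_at_bot] filterlim_uminus_at_top[THEN iffD1]
        filterlim_tendsto_pos_mult_at_top[OF tendsto_const] harm_at_top) auto
  have ge: "0 \<le> (\<Prod>k<n. (\<theta> + real (Suc k) * \<alpha>) / (\<theta> + real k * \<alpha> + 1))" for n
    using nn pos by (intro prod_nonneg) (auto simp: less_imp_le simp del: of_nat_Suc)
  show ?thesis
    by (rule tendsto_sandwich[OF always_eventually always_eventually tendsto_const lim])
       (intro allI ge le)+
qed

lemma PD_rho_first_stick_real:
  assumes \<theta>: "0 < \<theta> + \<alpha>" and t: "0 < t"
  shows "PD_rho \<alpha> \<theta> t = (\<integral>x. indicator {x. t * x < 1} x * PD_rho \<alpha> (\<theta> + \<alpha>) (t * (1 - x))
            \<partial>beta_measure (1 - \<alpha>) (\<theta> + \<alpha>))"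
proof -
  have [measurable]: "PD_rho \<alpha> (\<theta> + \<alpha>) \<in> borel_measurable borel"
    using \<alpha> \<theta> by (intro measurable_PD_rho) auto
  have "(\<integral>x. indicator {x. t * x < 1} x * PD_rho \<alpha> (\<theta> + \<alpha>) (t * (1 - x)) \<partial>beta_measure (1 - \<alpha>) (\<theta> + \<alpha>))
      = enn2real (\<integral>\<^sup>+x. ennreal (indicator {x. t * x < 1} x * PD_rho \<alpha> (\<theta> + \<alpha>) (t * (1 - x))) \<partial>beta_measure (1 - \<alpha>) (\<theta> + \<alpha>))"
    using \<alpha> by (intro integral_eq_nn_integral) (auto simp: PD_rho_bounds)
  also have "\<dots> = enn2real (ennreal (PD_rho \<alpha> \<theta> t))"
    unfolding PD_rho_first_stick[OF \<theta> t]
    by (intro arg_cong[of _ _ enn2real] nn_integral_cong) (auto simp: indicator_def)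
  finally show ?thesis using PD_rho_bounds by simp
qed

text \<open>At t = 1 the recursion evaluates the next \<rho> at 1 - x < 1, where it is already known
  to be 1.\<close>

lemma PD_rho_eq_1:
  assumes \<theta>: "0 < \<theta> + \<alpha>" and t: "t \<le> 1"
  shows "PD_rho \<alpha> \<theta> t = 1"
proof (cases "t = 1")
  case True
  interpret prob_space "beta_measure (1 - \<alpha>) (\<theta> + \<alpha>)"
    using \<alpha> \<theta> by (intro prob_space_beta_measure) auto
  have [measurable]: "PD_rho \<alpha> (\<theta> + \<alpha>) \<in> borel_measurable borel"
    using \<alpha> \<theta> by (intro measurable_PD_rho) auto
  have "PD_rho \<alpha> \<theta> 1 = (\<integral>x. 1 \<partial>beta_measure (1 - \<alpha>) (\<theta> + \<alpha>))"
    unfolding PD_rho_first_stick_real[OF \<theta> zero_less_one]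
  proof (rule integral_cong_AE)
    show "AE x in beta_measure (1 - \<alpha>) (\<theta> + \<alpha>). indicator {x. 1 * x < 1} x * PD_rho \<alpha> (\<theta> + \<alpha>) (1 * (1 - x)) = 1"
      using AE_beta_measure by eventually_elim (use \<alpha> \<theta> in \<open>auto intro!: PD_rho_eq_1_of_less_1\<close>)
  qed measurable
  then show ?thesis using True by (simp add: prob_space[simplified])
qed (use PD_rho_eq_1_of_less_1[OF \<theta>] t in auto)

text \<open>The complement of the recursion for \<rho>, put in the shape of
  \<open>PD_tail_first_stick\<close> with the same inhomogeneous term. For t x > 1 the two
  integrands add up to 1; for t x < 1 the first vanishes and the minimum equals t.\<close>

lemma PD_rho_tail_first_stick:
  assumes \<theta>: "0 < \<theta> + \<alpha>" and t: "0 < t"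
  shows "1 - PD_rho \<alpha> \<theta> t =
      (\<integral>w. indicator {w. 1 < t * w} w * PD_rho \<alpha> (\<theta> + \<alpha>) ((1 - w) / w) \<partial>beta_measure (1 - \<alpha>) (\<theta> + \<alpha>))
    + (\<integral>y. 1 - PD_rho \<alpha> (\<theta> + \<alpha>) ((1 - y) * min t (1 / y)) \<partial>beta_measure (1 - \<alpha>) (\<theta> + \<alpha>))"
proof -
  let ?B = "beta_measure (1 - \<alpha>) (\<theta> + \<alpha>)"
  define r where "r = PD_rho \<alpha> (\<theta> + \<alpha>)"
  interpret prob_space ?B using \<alpha> \<theta> by (intro prob_space_beta_measure) auto
  have [measurable]: "r \<in> borel_measurable borel"
    using \<alpha> \<theta> unfolding r_def by (intro measurable_PD_rho) auto
  have r: "0 \<le> r x" "r x \<le> 1" for x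
    using \<alpha> \<theta> by (auto simp: r_def PD_rho_bounds)
  have int: "integrable ?B (\<lambda>x. indicator {x. t * x < 1} x * r (t * (1 - x)))"
     "integrable ?B (\<lambda>w. indicator {w. 1 < t * w} w * r ((1 - w) / w))"
     "integrable ?B (\<lambda>y. 1 - r ((1 - y) * min t (1 / y)))"
    using r by (auto intro!: integrable_const_bound[where B = 1] simp: indicator_def)
  have "1 - PD_rho \<alpha> \<theta> t = (\<integral>x. 1 - indicator {x. t * x < 1} x * r (t * (1 - x)) \<partial>?B)"
    unfolding PD_rho_first_stick_real[OF \<theta> t] r_def[symmetric] using int
    by (simp add: prob_space[simplified])
  also have "\<dots> = (\<integral>y. indicator {w. 1 < t * w} y * r ((1 - y) / y) + (1 - r ((1 - y) * min t (1 / y))) \<partial>?B)"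
  proof (rule integral_cong_AE)
    show "AE x in ?B. 1 - indicator {x. t * x < 1} x * r (t * (1 - x))
        = indicator {w. 1 < t * w} x * r ((1 - x) / x) + (1 - r ((1 - x) * min t (1 / x)))"
      \<comment> \<open>At x = 1 / t both indicators vanish and the identity may fail, so this null
        point is excluded.\<close>
      using AE_beta_measure AE_beta_measure_neq[where c = "1 / t"]
    proof eventually_elim
      case (elim x)
      consider "t * x < 1" | "1 < t * x" using elim t by (force simp: field_simps)
      then show ?case
      proof cases
        case 1
        then have "min t (1 / x) = t" using elim by (simp add: field_simps min_def)
        then show ?thesis using 1 by (simp add: mult.commute)
      next
        case 2
        then have "min t (1 / x) = 1 / x" using elim by (simp add: field_simps min_def)
        then show ?thesis using 2 by simp
      qed
    qed
  qed measurable
  also have "\<dots> = (\<integral>w. indicator {w. 1 < t * w} w * r ((1 - w) / w) \<partial>?B) + (\<integral>y. 1 - r ((1 - y) * min t (1 / y)) \<partial>?B)"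
    by (intro Bochner_Integration.integral_add int)
  finally show ?thesis unfolding r_def .
qed

lemma enn2real_PD_tail_le:
  assumes "0 < \<theta> + \<alpha>" "0 \<le> t"
  shows "enn2real (PD_tail \<alpha> \<theta> t) \<le> t"
  using PD_tail_le[OF assms(1), of t] assms(2) by (simp add: enn2real_leI)

lemma ennreal_PD_tail:
  assumes "0 < \<theta> + \<alpha>"
  shows "ennreal (enn2real (PD_tail \<alpha> \<theta> t)) = PD_tail \<alpha> \<theta> t"
  by (intro ennreal_enn2real order.strict_trans1[OF PD_tail_le[OF assms]]) simp

lemma PD_tail_first_stick_real:
  assumes \<theta>: "0 < \<theta> + \<alpha>" and t: "0 < t"
  shows "enn2real (PD_tail \<alpha> \<theta> t) =
      (\<integral>w. indicator {w. 1 < t * w} w * PD_rho \<alpha> (\<theta> + \<alpha>) ((1 - w) / w) \<partial>beta_measure (1 - \<alpha>) (\<theta> + \<alpha>))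
    + (\<integral>y. enn2real (PD_tail \<alpha> (\<theta> + \<alpha>) ((1 - y) * min t (1 / y))) \<partial>beta_measure (1 - \<alpha>) (\<theta> + \<alpha>))"
proof -
  let ?B = "beta_measure (1 - \<alpha>) (\<theta> + \<alpha>)"
  have \<theta>': "0 < \<theta> + \<alpha> + \<alpha>" using \<theta> \<alpha> by auto
  have [measurable]: "PD_rho \<alpha> (\<theta> + \<alpha>) \<in> borel_measurable borel" "PD_tail \<alpha> (\<theta> + \<alpha>) \<in> borel_measurable borel"
    using \<alpha> \<theta>' by (intro measurable_PD_rho measurable_PD_tail; simp)+
  let ?f = "\<integral>\<^sup>+w. indicator {w. 1 < t * w} w * ennreal (PD_rho \<alpha> (\<theta> + \<alpha>) ((1 - w) / w)) \<partial>?B"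
  let ?g = "\<integral>\<^sup>+y. PD_tail \<alpha> (\<theta> + \<alpha>) ((1 - y) * min t (1 / y)) \<partial>?B"
  have sum: "PD_tail \<alpha> \<theta> t = ?f + ?g" by (rule PD_tail_first_stick[OF \<theta> t])
  have "PD_tail \<alpha> \<theta> t < \<top>"
    using PD_tail_le[OF \<theta>, of t] by (rule order.strict_trans1) simp
  \<comment> \<open>Finiteness of both summands is needed for \<open>enn2real\<close> to be additive
    here.\<close>
  then have fin: "?f < \<top>" "?g < \<top>" unfolding sum by auto
  have "(\<integral>w. indicator {w. 1 < t * w} w * PD_rho \<alpha> (\<theta> + \<alpha>) ((1 - w) / w) \<partial>?B)
      = enn2real (\<integral>\<^sup>+w. ennreal (indicator {w. 1 < t * w} w * PD_rho \<alpha> (\<theta> + \<alpha>) ((1 - w) / w)) \<partial>?B)"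
    using \<alpha> by (intro integral_eq_nn_integral) (auto simp: PD_rho_bounds)
  also have "\<dots> = enn2real ?f"
    by (intro arg_cong[of _ _ enn2real] nn_integral_cong) (auto simp: indicator_def)
  finally have f: "(\<integral>w. indicator {w. 1 < t * w} w * PD_rho \<alpha> (\<theta> + \<alpha>) ((1 - w) / w) \<partial>?B) = enn2real ?f" .
  have g: "(\<integral>y. enn2real (PD_tail \<alpha> (\<theta> + \<alpha>) ((1 - y) * min t (1 / y))) \<partial>?B) = enn2real ?g"
    using \<theta>' by (subst integral_eq_nn_integral) (auto simp: ennreal_PD_tail)
  show ?thesis
    unfolding f g sum using fin by (rule enn2real_plus)
qed

text \<open>Since \<open>1 - Y\<close> has mean \<open>(\<theta> + \<alpha>) / (\<theta> + 1)\<close>, the difference of two solutions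
  of the first-stick recursion that grow at most linearly is contracted by that factor at each step.\<close>

lemma PD_rho_eq_tail:
  assumes \<theta>: "0 < \<theta> + \<alpha>"
  shows "1 - PD_rho \<alpha> \<theta> t = enn2real (PD_tail \<alpha> \<theta> t)"
proof (cases "t \<le> 1")
  case True
  then show ?thesis using PD_rho_eq_1[OF \<theta>] PD_tail_eq_0 by simp
next
  case False
  then have t: "0 < t" by simp
  define D where "D = (\<lambda>\<theta> t. enn2real (PD_tail \<alpha> \<theta> t) - (1 - PD_rho \<alpha> \<theta> t))"
  \<comment> \<open>Each step raises \<theta> by \<alpha> and changes t, so the induction runs over
    all types and arguments at once.\<close>
  have bound: "\<bar>D \<theta> t\<bar> \<le> t * (\<Prod>k<n. (\<theta> + real (Suc k) * \<alpha>) / (\<theta> + real k * \<alpha> + 1))"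
    if "0 < \<theta> + \<alpha>" "0 < t" for \<theta> t n
    using that
  proof (induction n arbitrary: \<theta> t)
    case 0
    show ?case
    \<comment> \<open>For t \<le> 1 both tails vanish; for t > 1 both lie in [0, t], the tail of V_1
      because it is at most 1.\<close>
    proof (cases "t \<le> 1")
      case True
      then show ?thesis using 0 PD_rho_eq_1[of \<theta>] PD_tail_eq_0 by (simp add: D_def)
    next
      case False
      then show ?thesis
        using 0 enn2real_PD_tail_le[of \<theta> t] PD_rho_bounds[of \<theta> t] enn2real_nonneg[of "PD_tail \<alpha> \<theta> t"]
        by (simp add: D_def abs_le_iff del: enn2real_nonneg)
    qed
  next
    case (Suc n)
    let ?B = "beta_measure (1 - \<alpha>) (\<theta> + \<alpha>)"
    interpret prob_space ?B using \<alpha> Suc.prems by (intro prob_space_beta_measure) auto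
    have \<theta>': "0 < \<theta> + \<alpha> + \<alpha>" using Suc.prems \<alpha> by auto
    have [measurable]: "PD_rho \<alpha> (\<theta> + \<alpha>) \<in> borel_measurable borel" "PD_tail \<alpha> (\<theta> + \<alpha>) \<in> borel_measurable borel"
      using \<alpha> \<theta>' by (intro measurable_PD_rho measurable_PD_tail; simp)+
    have [measurable]: "D (\<theta> + \<alpha>) \<in> borel_measurable borel"
      unfolding D_def by measurable
    define P where "P = (\<Prod>k<n. (\<theta> + \<alpha> + real (Suc k) * \<alpha>) / (\<theta> + \<alpha> + real k * \<alpha> + 1))"
    define a where "a = (\<lambda>y. (1 - y) * min t (1 / y))"
    have [measurable]: "a \<in> borel_measurable borel" unfolding a_def by measurable
    have a: "AE y in ?B. 0 < a y \<and> a y \<le> t * (1 - y) \<and> t * (1 - y) \<le> t"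
      using AE_beta_measure
    proof eventually_elim
      case (elim y)
      have "(1 - y) * min t (1 / y) \<le> (1 - y) * t" using elim by (intro mult_left_mono) auto
      then show ?case using elim Suc.prems by (auto simp: a_def mult.commute mult_left_le)
    qed
    have int: "integrable ?B (\<lambda>y. enn2real (PD_tail \<alpha> (\<theta> + \<alpha>) (a y)))"
    proof (rule integrable_const_bound[where B = t])
      show "AE y in ?B. norm (enn2real (PD_tail \<alpha> (\<theta> + \<alpha>) (a y))) \<le> t"
        using a
      proof eventually_elim
        case (elim y)
        then show ?case using enn2real_PD_tail_le[OF \<theta>', of "a y"] by simp
      qed
    qed measurable
    have int2: "integrable ?B (\<lambda>y. 1 - PD_rho \<alpha> (\<theta> + \<alpha>) (a y))"
      using PD_rho_bounds \<theta>' by (intro integrable_const_bound[where B = 1]) auto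
    have P: "0 \<le> P"
      unfolding P_def
    proof (intro prod_nonneg ballI divide_nonneg_nonneg)
      fix k
      show "0 \<le> \<theta> + \<alpha> + real (Suc k) * \<alpha>" "0 \<le> \<theta> + \<alpha> + real k * \<alpha> + 1"
        using Suc.prems \<alpha> by (auto intro!: add_nonneg_nonneg)
    qed
    \<comment> \<open>The two recursions share their inhomogeneous term, which cancels in the
      difference.\<close>
    have eq: "D \<theta> t = (\<integral>y. D (\<theta> + \<alpha>) (a y) \<partial>?B)"
      using PD_tail_first_stick_real[OF Suc.prems] PD_rho_tail_first_stick[OF Suc.prems] int int2
      unfolding D_def a_def by simp
    have "\<bar>D \<theta> t\<bar> \<le> (\<integral>y. \<bar>D (\<theta> + \<alpha>) (a y)\<bar> \<partial>?B)"
      unfolding eq by (rule integral_abs_bound)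
    also have "\<dots> \<le> (\<integral>y. t * P * (1 - y) \<partial>?B)"
    proof (rule integral_mono_AE)
      show "integrable ?B (\<lambda>y. \<bar>D (\<theta> + \<alpha>) (a y)\<bar>)"
        using int int2 unfolding D_def by auto
      have "AE y in ?B. norm (1 - y) \<le> 1"
        using AE_beta_measure by eventually_elim auto
      then have "integrable ?B (\<lambda>y. 1 - y)"
        by (rule integrable_const_bound) measurable
      then show "integrable ?B (\<lambda>y. t * P * (1 - y))" by (rule integrable_mult_right)
      show "AE y in ?B. \<bar>D (\<theta> + \<alpha>) (a y)\<bar> \<le> t * P * (1 - y)"
        using a
      proof eventually_elim
        case (elim y)
        then have "\<bar>D (\<theta> + \<alpha>) (a y)\<bar> \<le> a y * P"
          unfolding P_def using \<theta>' by (intro Suc.IH) auto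
        also have "\<dots> \<le> t * (1 - y) * P" using elim P by (intro mult_right_mono) auto
        finally show ?case by (simp add: mult_ac)
      qed
    qed
    also have "\<dots> = t * P * ((\<theta> + \<alpha>) / (\<theta> + 1))"
      using expectation_beta_measure[of "1 - \<alpha>" "\<theta> + \<alpha>"] Suc.prems \<alpha> by (simp add: add_ac)
    \<comment> \<open>The mean just gained is the factor k = 0; the factors of type \<theta> +
      \<alpha> are those of type \<theta> with the index shifted by one.\<close>
    also have "\<dots> = t * (\<Prod>k<Suc n. (\<theta> + real (Suc k) * \<alpha>) / (\<theta> + real k * \<alpha> + 1))"
      unfolding prod.lessThan_Suc_shift P_def by (simp add: algebra_simps)
    finally show ?case .
  qed
  have lim: "(\<lambda>n. t * (\<Prod>k<n. (\<theta> + real (Suc k) * \<alpha>) / (\<theta> + real k * \<alpha> + 1))) \<longlonglongrightarrow> t * 0"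
    by (intro tendsto_intros prod_stick_means_tendsto_0 \<alpha> \<theta>)
  have "\<bar>D \<theta> t\<bar> \<le> t * 0"
    by (rule LIMSEQ_le_const[OF lim]) (intro exI allI impI bound[OF \<theta> t])
  then show ?thesis by (simp add: D_def)
qed

section \<open>Density of the Stieltjes measure\<close>

text \<open>Substitute w = 1 / u in the size-biased tail; the powers of u from the density, the
  factor 1 / w and the Jacobian collect to u^(-\<theta>).\<close>

lemma PD_tail_eq_density:
  assumes \<theta>: "0 < \<theta> + \<alpha>"
  shows "PD_tail \<alpha> \<theta> t = (\<integral>\<^sup>+u. ennreal (PD_inverse_density \<alpha> \<theta> u) * indicator {..t} u \<partial>lborel)"
    (is "_ = (\<integral>\<^sup>+u. ennreal (?d u) * _ \<partial>lborel)")
proof (cases "t \<le> 1")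
  case True
  have "(\<integral>\<^sup>+u. ennreal (?d u) * indicator {..t} u \<partial>lborel) = (\<integral>\<^sup>+u. 0 \<partial>(lborel :: real measure))"
    by (intro nn_integral_cong) (use True in \<open>auto simp: PD_inverse_density_def indicator_def\<close>)
  then show ?thesis using PD_tail_eq_0[OF True] by simp
next
  case False
  define b where "b = beta_density (1 - \<alpha>) (\<theta> + \<alpha>)"
  define r where "r = PD_rho \<alpha> (\<theta> + \<alpha>)"
  have [measurable]: "b \<in> borel_measurable borel" "r \<in> borel_measurable borel"
    using \<alpha> \<theta> by (auto simp: b_def r_def intro!: measurable_PD_rho)
  have nn: "0 \<le> b x" "0 \<le> r x" for x
    using \<alpha> \<theta> by (auto simp: b_def r_def beta_density_nonneg PD_rho_bounds)
  have b0: "b x = 0" if "\<not> (0 < x \<and> x < 1)" for x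
    using that by (auto simp: b_def beta_density_def)
  have "PD_tail \<alpha> \<theta> t = (\<integral>\<^sup>+w. ennreal (b w) * (indicator {w. 1 < t * w} w * ennreal (r ((1 - w) / w) / w)) \<partial>lborel)"
    unfolding PD_tail_def b_def r_def[symmetric] by (rule nn_integral_beta_measure) measurable
  also have "\<dots> = (\<integral>\<^sup>+w. ennreal (b w * (r ((1 - w) / w) / w)) * indicator {1 / t..1} w \<partial>lborel)"
  proof (rule nn_integral_cong_AE)
    show "AE w in lborel. ennreal (b w) * (indicator {w. 1 < t * w} w * ennreal (r ((1 - w) / w) / w))
        = ennreal (b w * (r ((1 - w) / w) / w)) * indicator {1 / t..1} w"
      using AE_lborel_singleton[of "1 / t"]
    proof eventually_elim
      case (elim w)
      show ?case
      proof (cases "0 < w \<and> w < 1")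
        case True
        then have i: "indicator {w. 1 < t * w} w = (indicator {1 / t..1} w :: ennreal)"
          using elim False by (auto simp: indicator_def field_simps)
        have "ennreal (b w * (r ((1 - w) / w) / w)) = ennreal (b w) * ennreal (r ((1 - w) / w) / w)"
          using True nn by (intro ennreal_mult) auto
        then show ?thesis unfolding i by (simp only: mult_ac)
      qed (simp add: b0)
    qed
  qed
  also have "\<dots> = (\<integral>\<^sup>+u. ennreal (b (1 / u) * (r ((1 - 1 / u) / (1 / u)) / (1 / u)) / u\<^sup>2) * indicator {1..t} u \<partial>lborel)"
    using False by (intro nn_integral_inverse_substitution) auto
  also have "\<dots> = (\<integral>\<^sup>+u. ennreal (?d u) * indicator {..t} u \<partial>lborel)"
  proof (rule nn_integral_cong)
    fix u :: real
    show "ennreal (b (1 / u) * (r ((1 - 1 / u) / (1 / u)) / (1 / u)) / u\<^sup>2) * indicator {1..t} u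
        = ennreal (?d u) * indicator {..t} u"
    proof (cases "1 < u")
      case True
      have e: "(1 - 1 / u) / (1 / u) = u - 1" "1 - 1 / u = (u - 1) / u"
        using True by (simp_all add: field_simps)
      have p: "(1 / u) powr (- \<alpha>) = u powr \<alpha>"
        using True by (simp add: powr_minus powr_divide)
      have "b (1 / u) = u powr \<alpha> * ((u - 1) powr (\<theta> + \<alpha> - 1) / u powr (\<theta> + \<alpha> - 1)) / Beta (1 - \<alpha>) (\<theta> + \<alpha>)"
        unfolding b_def beta_density_def e using True p by (simp add: powr_divide)
      then have "b (1 / u) * (r (u - 1) / (1 / u)) / u\<^sup>2
         = (u powr \<alpha> / u powr (\<theta> + \<alpha> - 1) / u) * ((u - 1) powr (\<theta> + \<alpha> - 1) * r (u - 1) / Beta (1 - \<alpha>) (\<theta> + \<alpha>))"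
        using True by (simp add: power2_eq_square)
      also have "u powr \<alpha> / u powr (\<theta> + \<alpha> - 1) / u = u powr - \<theta>"
        using True by (simp add: powr_minus_divide powr_add powr_diff)
      also have "u powr - \<theta> * ((u - 1) powr (\<theta> + \<alpha> - 1) * r (u - 1) / Beta (1 - \<alpha>) (\<theta> + \<alpha>)) = ?d u"
        using True by (simp add: PD_inverse_density_def r_def)
      finally show ?thesis
        unfolding e(1) using True by (auto simp: indicator_def)
    next
      case False
      then have "ennreal (?d u) = 0" by (simp add: PD_inverse_density_def)
      then show ?thesis
        using False b0[of "1 / u"] by (auto simp: indicator_def)
    qed
  qed
  finally show ?thesis .
qed

text \<open>The measure with this density is finite and has distribution function 1 - \<rho>, which
  determines it. The right continuity required for the Stieltjes measure is thereby inherited from a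
  distribution function.\<close>

lemma interval_measure_PD_rho:
  assumes \<theta>: "0 < \<theta> + \<alpha>"
  shows "interval_measure (\<lambda>t. - PD_rho \<alpha> \<theta> t) = density lborel (\<lambda>u. ennreal (PD_inverse_density \<alpha> \<theta> u))"
proof -
  define M where "M = density lborel (\<lambda>u. ennreal (PD_inverse_density \<alpha> \<theta> u))"
  have [measurable]: "PD_rho \<alpha> (\<theta> + \<alpha>) \<in> borel_measurable borel"
    using \<alpha> \<theta> by (intro measurable_PD_rho) auto
  have [measurable]: "PD_inverse_density \<alpha> \<theta> \<in> borel_measurable borel"
    unfolding PD_inverse_density_def by measurable
  have Iic: "emeasure M {..t} = ennreal (1 - PD_rho \<alpha> \<theta> t)" for t
    using PD_tail_eq_density[OF \<theta>, of t] ennreal_PD_tail[OF \<theta>, of t]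
    by (simp add: M_def emeasure_density PD_rho_eq_tail[OF \<theta>])
  have "emeasure M UNIV = (SUP n. emeasure M {..real n})"
  proof (subst SUP_emeasure_incseq)
    show "emeasure M UNIV = emeasure M (\<Union>n. {..real n})"
      by (intro arg_cong[of _ _ "emeasure M"]) (auto intro: real_arch_simple)
  qed (auto simp: M_def incseq_def)
  also have "\<dots> \<le> 1"
    unfolding Iic using PD_rho_bounds(1) by (intro SUP_least) simp
  finally have "emeasure M UNIV \<le> 1" .
  then have "emeasure M (space M) \<noteq> \<infinity>" by (auto simp: M_def top_unique)
  then interpret M: finite_borel_measure M
    by (intro finite_borel_measure.intro finite_borel_measure_axioms.intro finite_measureI)
       (simp_all add: M_def)
  have cdf: "cdf M t = 1 - PD_rho \<alpha> \<theta> t" for t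
    using PD_rho_bounds(2)[OF \<theta>] by (simp add: cdf_def measure_def Iic)
  \<comment> \<open>Only increments enter, so the additive constant 1 drops out.\<close>
  have "interval_measure (\<lambda>t. - PD_rho \<alpha> \<theta> t) = interval_measure (cdf M)"
    unfolding interval_measure_def cdf by simp
  also have "\<dots> = M"
  proof (rule cdf_unique')
    show "finite_borel_measure M" by (rule M.finite_borel_measure_axioms)
    show "finite_borel_measure (interval_measure (cdf M))"
      using M.cdf_nondecreasing M.cdf_is_right_cont M.cdf_lim_at_bot M.cdf_lim_at_top measure_nonneg
      by (rule finite_borel_measure_interval_measure)
    show "cdf (interval_measure (cdf M)) = cdf M"
      using M.cdf_nondecreasing M.cdf_is_right_cont M.cdf_lim_at_bot by (rule cdf_interval_measure)
  qed
  finally show ?thesis unfolding M_def .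
qed

end

section \<open>The integral equation\<close>

theorem theorem4p2:
  fixes \<alpha> \<theta> s :: real
  assumes "0 \<le> \<alpha>" and "\<alpha> < 1" and "\<theta> > - \<alpha>" and "s > 1"
  shows "(s - 1) powr \<theta> * PD_rho \<alpha> \<theta> (s - 1)
         + LS_integral_decr (PD_rho \<alpha> \<theta>) (s - 1) s (\<lambda>t. (s - t) powr (- \<alpha>) * t powr \<theta>) = 0"
proof -
  note \<alpha> = assms(1,2)
  have \<theta>: "0 < \<theta> + \<alpha>" using assms by simp
  define S where "S = s - 1"
  have S: "0 < S" using assms by (simp add: S_def)
  define r where "r = PD_rho \<alpha> (\<theta> + \<alpha>)"
  define B where "B = Beta (1 - \<alpha>) (\<theta> + \<alpha>)"
  define b where "b = beta_density (1 - \<alpha>) (\<theta> + \<alpha>)"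
  define d where "d = PD_inverse_density \<alpha> \<theta>"
  have d_eq: "d u = indicator {1<..} u * (u powr - \<theta> * (u - 1) powr (\<theta> + \<alpha> - 1) * r (u - 1) / B)" for u
    by (simp add: d_def PD_inverse_density_def r_def B_def)
  define h where "h = (\<lambda>t. d t * (indicator {S<..s} t * ((s - t) powr (- \<alpha>) * t powr \<theta>)))"
  have [measurable]: "r \<in> borel_measurable borel"
    using \<alpha> \<theta> unfolding r_def by (intro measurable_PD_rho) auto
  have [measurable]: "d \<in> borel_measurable borel" unfolding d_eq[abs_def] by measurable
  have "0 < B" using \<alpha> \<theta> unfolding B_def by (intro Beta_real_pos) auto
  then have d: "0 \<le> d u" for u
    using \<alpha> by (auto simp: d_eq r_def PD_rho_bounds indicator_def)
  have "LS_integral_decr (PD_rho \<alpha> \<theta>) S s (\<lambda>t. (s - t) powr (- \<alpha>) * t powr \<theta>) = - (\<integral>t. h t \<partial>lborel)"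
    unfolding LS_integral_decr_def interval_measure_PD_rho[OF \<alpha> \<theta>] set_lebesgue_integral_def d_def[symmetric]
    using d by (subst integral_density) (auto simp: h_def)
  \<comment> \<open>With t = s - S y, the conditions t > S, t \<le> s and t > 1 become S y < 1, y
    \<ge> 0 and y < 1: the support of the Beta density together with the event of the
    recursion.\<close>
  also have "(\<integral>t. h t \<partial>lborel) = \<bar>- S\<bar> *\<^sub>R (\<integral>y. h (s + - S * y) \<partial>lborel)"
    using S by (intro lborel_integral_real_affine) simp
  also have "\<dots> = (\<integral>y. S * h (s + - S * y) \<partial>lborel)"
    using S by simp
  also have "\<dots> = (\<integral>y. S powr \<theta> * (b y * (indicator {y. S * y < 1} y * r (S * (1 - y)))) \<partial>lborel)"
  proof (intro Bochner_Integration.integral_cong refl)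
    fix y :: real
    have e: "s + - S * y - 1 = S * (1 - y)" "s - (s + - S * y) = S * y"
      by (simp_all add: S_def algebra_simps)
    show "S * h (s + - S * y) = S powr \<theta> * (b y * (indicator {y. S * y < 1} y * r (S * (1 - y))))"
    proof (cases "0 < y \<and> y < 1 \<and> S * y < 1")
      case True
      have pos: "0 < S * (1 - y)" using S True by simp
      then have t: "1 < s + - S * y" using e(1) by linarith
      have "0 < S * y" using True S by simp
      moreover have "s = S + 1" by (simp add: S_def)
      ultimately have "s + - S * y \<in> {S<..s}" using True by simp
      then have "h (s + - S * y) = ((s + - S * y) powr - \<theta> * (s + - S * y) powr \<theta>)
          * (S * (1 - y)) powr (\<theta> + \<alpha> - 1) * r (S * (1 - y)) / B * (S * y) powr (- \<alpha>)"
        unfolding h_def d_eq e using t by simp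
      also have "(s + - S * y) powr - \<theta> * (s + - S * y) powr \<theta> = 1"
        using t by (subst powr_add[symmetric]) simp
      finally have "S * h (s + - S * y) = (S * (S powr (\<theta> + \<alpha> - 1) * S powr (- \<alpha>)))
          * ((1 - y) powr (\<theta> + \<alpha> - 1) * y powr (- \<alpha>) / B * r (S * (1 - y)))"
        using S True by (simp add: powr_mult)
      \<comment> \<open>The Jacobian S, the factor from (t - 1)^(\<theta> + \<alpha> - 1) and the
        one from (s - t)^(-\<alpha>) combine to S^\<theta>.\<close>
      also have "S * (S powr (\<theta> + \<alpha> - 1) * S powr (- \<alpha>)) = S powr \<theta>"
        using S powr_mult_base[of S "\<theta> - 1"] by (simp flip: powr_add)
      finally show ?thesis
        using True by (simp add: b_def beta_density_def B_def)
    next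
      case False
      have "h (s + - S * y) = 0"
      \<comment> \<open>At y = 0 the kernel is \<open>0 powr (- \<alpha>)\<close>, which is 0 by
        convention even for \<alpha> = 0.\<close>
      proof (cases "y = 0")
        case True
        then show ?thesis by (simp add: h_def)
      next
        case F: False
        have "y < 0 \<or> 1 \<le> y \<or> 1 \<le> S * y" using False F by linarith
        then show ?thesis
        proof (elim disjE)
          assume "y < 0"
          then have "s + - S * y \<notin> {S<..s}" using S by (auto simp: not_le mult_pos_neg)
          then show ?thesis by (simp add: h_def)
        next
          assume "1 \<le> y"
          then have "S * (1 - y) \<le> 0" using S by (simp add: mult_nonneg_nonpos)
          then have "s + - S * y \<notin> {1<..}" using e(1) by simp
          then show ?thesis by (simp add: h_def d_eq)
        next
          assume "1 \<le> S * y"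
          moreover have "s = S + 1" by (simp add: S_def)
          ultimately have "s + - S * y \<notin> {S<..s}" by simp
          then show ?thesis by (simp add: h_def)
        qed
      qed
      moreover have "b y * indicator {y. S * y < 1} y = 0"
        using False by (auto simp: b_def beta_density_def indicator_def)
      ultimately show ?thesis by auto
    qed
  qed
  also have "\<dots> = S powr \<theta> * (\<integral>y. b y * (indicator {y. S * y < 1} y * r (S * (1 - y))) \<partial>lborel)"
    by simp
  also have "(\<integral>y. b y * (indicator {y. S * y < 1} y * r (S * (1 - y))) \<partial>lborel)
      = (\<integral>y. indicator {y. S * y < 1} y * r (S * (1 - y)) \<partial>beta_measure (1 - \<alpha>) (\<theta> + \<alpha>))"
    unfolding b_def using \<alpha> \<theta> by (intro integral_beta_measure[symmetric]) auto
  also have "\<dots> = PD_rho \<alpha> \<theta> S"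
    unfolding r_def by (rule PD_rho_first_stick_real[OF \<alpha> \<theta> S, symmetric])
  finally show ?thesis unfolding S_def by simp
qed

end
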